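(* Let $G$ be a tree or a forest, randomly oriented, and let $a,s,b$ be three distinct vertices of $G$. Then the events $\{a\to s\}$ and $\{s\to b\}$ are either independent or mutually exclusive.
   Context: A graph is randomly oriented if each edge is independently given one of its two possible directions, each with probability $\frac12$. For vertices $u\ne v$, $\{u\to v\}$ denotes the event that there is a directed path from $u$ to $v$. Mutually exclusive means that the intersection of the two events is empty. *)

theory Defs
  imports "HOL-Probability.Probability"
begin

text \<open>Edges are unordered pairs, i.e. two-element sets of vertices. Graphs may be infinite.\<close>

definition simple_graph :: "'a set \<Rightarrow> 'a set set \<Rightarrow> bool" where
  "simple_graph V E \<longleftrightarrow> (\<forall>e\<in>E. e \<subseteq> V \<and> card e = 2)"

definition is_cycle :: "'a set set \<Rightarrow> 'a list \<Rightarrow> bool" where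
  "is_cycle E p \<longleftrightarrow>
     length p \<ge> 3 \<and> distinct p \<and> successively (\<lambda>u v. {u, v} \<in> E) (p @ [hd p])"

text \<open>Trees are the connected forests, so they are included here.\<close>

definition forest :: "'a set \<Rightarrow> 'a set set \<Rightarrow> bool" where
  "forest V E \<longleftrightarrow> simple_graph V E \<and> (\<nexists>p. is_cycle E p)"

text \<open>
  An orientation is a function that maps each edge to one of its two endpoints, which is
  taken to be the head of the edge. The heads are independent and uniformly distributed, so
  each edge has either direction with probability 1/2. The sample space is
  \<open>\<Pi>\<^sub>E e\<in>E. e\<close>, i.e. exactly the set of all orientations.
\<close>

definition random_orientation :: "'a set set \<Rightarrow> ('a set \<Rightarrow> 'a) measure" where
  "random_orientation E = PiM E (\<lambda>e. uniform_count_measure e)"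

lemma space_random_orientation: "space (random_orientation E) = (\<Pi>\<^sub>E e\<in>E. e)"
  by (simp add: random_orientation_def space_PiM space_uniform_count_measure)

lemma prob_space_random_orientation:
  assumes "simple_graph V E"
  shows "prob_space (random_orientation E)"
  unfolding random_orientation_def
proof (rule prob_space_PiM)
  fix e assume "e \<in> E"
  then have "card e = 2" using assms by (simp add: simple_graph_def)
  then have "finite e" "e \<noteq> {}" by (auto intro: card_ge_0_finite)
  then show "prob_space (uniform_count_measure e)"
    by (rule prob_space_uniform_count_measure)
qed

definition oriented_arcs :: "'a set set \<Rightarrow> ('a set \<Rightarrow> 'a) \<Rightarrow> ('a \<times> 'a) set" where
  "oriented_arcs E \<omega> = {(u, v). {u, v} \<in> E \<and> \<omega> {u, v} = v}"

definition directed_path :: "('a \<times> 'a) set \<Rightarrow> 'a \<Rightarrow> 'a list \<Rightarrow> 'a \<Rightarrow> bool" where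
  "directed_path A u p v \<longleftrightarrow>
     p \<noteq> [] \<and> hd p = u \<and> last p = v \<and> distinct p \<and> successively (\<lambda>x y. (x, y) \<in> A) p"

definition path_event :: "'a set set \<Rightarrow> 'a \<Rightarrow> 'a \<Rightarrow> ('a set \<Rightarrow> 'a) set" where
  "path_event E u v =
     {\<omega> \<in> space (random_orientation E). \<exists>p. directed_path (oriented_arcs E \<omega>) u p v}"

end

theory Submission imports Defs begin

text \<open>
  In a forest two vertices are joined by at most one path, so \<open>{a \<rightarrow> s}\<close> is the event
  that all edges of one fixed path \<open>p\<close> point towards \<open>s\<close>, and \<open>{s \<rightarrow> b}\<close> is the event
  that all edges of one fixed path \<open>q\<close> point away from \<open>s\<close>.

  Assume that some orientation lies in both events. If \<open>p\<close> and \<open>q\<close> had a common edge,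
  oriented \<open>x \<rightarrow> y\<close>, say, then \<open>p\<close> would lead on from \<open>y\<close> to \<open>s\<close> and \<open>q\<close> from
  \<open>s\<close> to \<open>x\<close>; the edge would close a cycle, which a forest does not have
  (\<open>common_arc_impossible\<close>). Hence \<open>p\<close> and \<open>q\<close> have no common edge, the two events are
  determined by disjoint sets of edges, and they are independent because the heads of the
  edges are (\<open>indep_event_PiM_cylinders\<close>).

  Both graph-theoretic facts, uniqueness of paths and disjointness of edges, come from one
  observation: in a forest, the only path between the ends of an edge is the edge itself
  (\<open>forest_path_between_adjacent\<close>). Walks are handled through the reflexive transitive closure
  of an arc set, so that they can be concatenated freely, and are cut down to paths only
  at the end (\<open>rtrancl_imp_directed_path\<close>).
\<close>

section \<open>Paths and reachability\<close>

definition adjacency :: "'a set set \<Rightarrow> ('a \<times> 'a) set" where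
  "adjacency E = {(u, v). {u, v} \<in> E}"

lemma directed_path_mono:
  "directed_path A u p v \<Longrightarrow> A \<subseteq> B \<Longrightarrow> directed_path B u p v"
  unfolding directed_path_def by (auto elim: successively_mono)

lemma oriented_arcs_subset_adjacency: "oriented_arcs E \<omega> \<subseteq> adjacency E"
  by (auto simp: oriented_arcs_def adjacency_def)

lemma directed_path_Cons:
  "directed_path A u (w # p) v \<longleftrightarrow>
     w = u \<and> (p = [] \<and> u = v \<or> u \<notin> set p \<and> (u, hd p) \<in> A \<and> directed_path A (hd p) p v)"
  by (cases p) (auto simp: directed_path_def)

lemma successively_imp_rtrancl:
  "successively (\<lambda>x y. (x, y) \<in> A) p \<Longrightarrow> p \<noteq> [] \<Longrightarrow> (hd p, last p) \<in> A\<^sup>*"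
  by (induction p rule: induct_list012) (auto intro: converse_rtrancl_into_rtrancl)

lemma rtrancl_imp_directed_path:
  assumes "(u, v) \<in> A\<^sup>*"
  shows "\<exists>p. directed_path A u p v"
  using assms
proof (induction rule: converse_rtrancl_induct)
  case base
  have "directed_path A v [v] v" by (simp add: directed_path_def)
  then show ?case ..
next
  case (step u w)
  then obtain p where p: "directed_path A w p v" by blast
  show ?case
  proof (cases "u \<in> set p")
    case True
    \<comment> \<open>The path already visits \<open>u\<close>: keep only its part from there on.\<close>
    then obtain xs ys where "p = xs @ u # ys" by (auto simp: in_set_conv_decomp)
    then have "directed_path A u (u # ys) v"
      using p by (auto simp: directed_path_def successively_append_iff)
    then show ?thesis ..
  next
    case False
    then have "directed_path A u (u # p) v"
      using p step.hyps(1) by (auto simp: directed_path_def successively_Cons)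
    then show ?thesis ..
  qed
qed

section \<open>Paths in a forest\<close>

text \<open>A path with at least three vertices whose ends are adjacent would close up to a cycle.\<close>

lemma forest_path_between_adjacent:
  assumes "forest V E" "directed_path (adjacency E) u p v" "{u, v} \<in> E"
  shows "p = [u, v]"
proof -
  have "u \<noteq> v" using assms(1,3) by (auto simp: forest_def simple_graph_def)
  have "\<not> length p \<ge> 3"
  proof
    assume "length p \<ge> 3"
    then have "is_cycle E p"
      using assms(2,3)
      by (auto simp: is_cycle_def directed_path_def adjacency_def successively_append_iff
          insert_commute)
    then show False using assms(1) by (auto simp: forest_def)
  qed
  then have "length p \<le> 2" by simp
  then show ?thesis
    using assms(2) \<open>u \<noteq> v\<close> by (cases p; cases "tl p") (auto simp: directed_path_def)
qed

text \<open>
  If two paths diverged right after their first vertex \<open>u\<close>, towards \<open>x\<close> and \<open>y\<close>, then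
  going along one to the common end and back along the other would connect \<open>x\<close> with
  \<open>y\<close> without meeting \<open>u\<close>, and prepending \<open>u\<close> would give a path from \<open>u\<close> to its neighbour
  \<open>y\<close> other than their edge.
\<close>

lemma forest_path_unique:
  assumes "forest V E" "directed_path (adjacency E) u p v" "directed_path (adjacency E) u q v"
  shows "p = q"
  using assms(2,3)
proof (induction p arbitrary: u q)
  case Nil
  then show ?case by (simp add: directed_path_def)
next
  case (Cons w p)
  let ?A = "adjacency E"
  obtain q' where q: "q = u # q'"
    using Cons.prems(2) by (cases q) (auto simp: directed_path_def)
  have w: "w = u" using Cons.prems(1) by (simp add: directed_path_Cons)
  show ?case
  proof (cases "u = v")
    case True
    then have "p = []" "q' = []"
      using Cons.prems q w by (auto simp: directed_path_def split: if_splits)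
    then show ?thesis using w q by simp
  next
    case False
    define x where "x = hd p"
    define y where "y = hd q'"
    have p: "u \<notin> set p" "(u, x) \<in> ?A" "directed_path ?A x p v"
      using Cons.prems(1) False by (auto simp: directed_path_Cons x_def)
    have q': "u \<notin> set q'" "(u, y) \<in> ?A" "directed_path ?A y q' v"
      using Cons.prems(2) False q by (auto simp: directed_path_Cons y_def)
    define B where "B = {(c, d) \<in> ?A. c \<noteq> u \<and> d \<noteq> u}"
    have avoid: "(hd r, last r) \<in> B\<^sup>*"
      if "r \<noteq> []" "u \<notin> set r" "successively (\<lambda>c d. (c, d) \<in> ?A) r" for r
    proof -
      have "successively (\<lambda>c d. (c, d) \<in> B) r"
        by (rule successively_mono[OF that(3)]) (use that(2) in \<open>auto simp: B_def\<close>)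
      then show ?thesis using that(1) by (rule successively_imp_rtrancl)
    qed
    have xv: "(x, v) \<in> B\<^sup>*" and yv: "(y, v) \<in> B\<^sup>*"
      using avoid[of p] avoid[of q'] p q' by (auto simp: directed_path_def)
    have "sym (B\<^sup>*)"
      by (rule sym_rtrancl) (auto simp: sym_def B_def adjacency_def insert_commute)
    then have "(v, y) \<in> B\<^sup>*" using yv by (rule symD)
    with xv have "(x, y) \<in> B\<^sup>*" by (rule rtrancl_trans)
    then obtain r where r: "directed_path B x r y"
      using rtrancl_imp_directed_path by metis
    have "x \<noteq> u" using p by (cases p) (auto simp: directed_path_def)
    have "u \<notin> set r"
    proof
      assume "u \<in> set r"
      then obtain xs ys where split: "r = xs @ u # ys" by (auto simp: in_set_conv_decomp)
      \<comment> \<open>\<open>r\<close> does not start in \<open>u\<close>, so it would have to enter \<open>u\<close> by an arc of \<open>B\<close>.\<close>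
      moreover have "xs \<noteq> []" using r \<open>x \<noteq> u\<close> split by (auto simp: directed_path_def)
      ultimately show False
        using r by (auto simp: directed_path_def successively_append_iff B_def)
    qed
    moreover have "directed_path ?A x r y"
      using r by (rule directed_path_mono) (auto simp: B_def)
    ultimately have "directed_path ?A u (u # r) y"
      using p(2) by (auto simp: directed_path_def successively_Cons)
    moreover have "{u, y} \<in> E" using q'(2) by (simp add: adjacency_def)
    ultimately have "u # r = [u, y]" by (rule forest_path_between_adjacent[OF assms(1)])
    then have "x = y" using r by (simp add: directed_path_def)
    then have "p = q'" using Cons.IH[OF p(3)] q'(3) by simp
    then show ?thesis using q w by simp
  qed
qed

definition path_arcs :: "'a list \<Rightarrow> ('a \<times> 'a) set" where
  "path_arcs p = set (zip p (tl p))"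

definition path_edges :: "'a list \<Rightarrow> 'a set set" where
  "path_edges p = (\<lambda>(x, y). {x, y}) ` path_arcs p"

lemma successively_iff_path_arcs:
  "successively (\<lambda>x y. (x, y) \<in> A) p \<longleftrightarrow> path_arcs p \<subseteq> A"
  by (induction p rule: induct_list012) (auto simp: path_arcs_def)

lemma finite_path_edges: "finite (path_edges p)"
  by (simp add: path_edges_def path_arcs_def)

lemma path_edges_subset:
  assumes "directed_path (adjacency E) u p v"
  shows "path_edges p \<subseteq> E"
proof -
  have "path_arcs p \<subseteq> adjacency E"
    using assms by (simp add: directed_path_def successively_iff_path_arcs)
  then show ?thesis by (auto simp: path_edges_def adjacency_def)
qed

lemma path_arcs_split:
  "(x, y) \<in> path_arcs p \<Longrightarrow> \<exists>xs ys. p = xs @ x # y # ys"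
proof (induction p rule: induct_list012)
  case (3 c d zs)
  show ?case
  proof (cases "(x, y) = (c, d)")
    case True
    then have "c # d # zs = [] @ x # y # zs" by simp
    then show ?thesis by blast
  next
    case False
    then have "(x, y) \<in> path_arcs (d # zs)" using 3(3) by (auto simp: path_arcs_def)
    then obtain xs ys where "d # zs = xs @ x # y # ys" using 3(2) by blast
    then have "c # d # zs = (c # xs) @ x # y # ys" by simp
    then show ?thesis by blast
  qed
qed (auto simp: path_arcs_def)

text \<open>
  After the common arc \<open>(x, y)\<close>, the first path leads from \<open>y\<close> to \<open>s\<close>; before it, the second
  leads from \<open>s\<close> to \<open>x\<close>. So \<open>x\<close> is reachable from its neighbour \<open>y\<close>, which in a forest
  is possible only along their edge, and that edge points the other way.
\<close>

lemma common_arc_impossible: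
  assumes "forest V E"
    and p: "directed_path (oriented_arcs E \<omega>) a p s"
    and q: "directed_path (oriented_arcs E \<omega>) s q b"
    and "(x, y) \<in> path_arcs p" "(x, y) \<in> path_arcs q"
  shows False
proof -
  let ?A = "oriented_arcs E \<omega>"
  obtain p1 p2 where p12: "p = p1 @ x # y # p2" using path_arcs_split assms(4) by metis
  obtain q1 q2 where q12: "q = (q1 @ [x]) @ y # q2"
    using path_arcs_split[OF assms(5)] by auto
  have xy: "(x, y) \<in> ?A"
    using p p12 by (auto simp: directed_path_def successively_append_iff)
  have "(y, s) \<in> ?A\<^sup>*"
    using successively_imp_rtrancl[of ?A "y # p2"] p p12
    by (auto simp: directed_path_def successively_append_iff)
  moreover have "successively (\<lambda>x y. (x, y) \<in> ?A) (q1 @ [x])"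
    using q unfolding q12 directed_path_def successively_append_iff by blast
  then have "(hd (q1 @ [x]), last (q1 @ [x])) \<in> ?A\<^sup>*"
    by (rule successively_imp_rtrancl) simp
  moreover have "hd (q1 @ [x]) = s"
    using q q12 by (cases q1) (auto simp: directed_path_def)
  ultimately have "(y, x) \<in> ?A\<^sup>*" by simp
  then obtain r where r: "directed_path ?A y r x"
    using rtrancl_imp_directed_path by metis
  have "{y, x} \<in> E" using xy by (simp add: oriented_arcs_def insert_commute)
  then have "r = [y, x]"
    by (rule forest_path_between_adjacent
        [OF assms(1) directed_path_mono[OF r oriented_arcs_subset_adjacency]])
  then have "(y, x) \<in> ?A" "x \<noteq> y" using r by (auto simp: directed_path_def)
  then show False using xy by (auto simp: oriented_arcs_def insert_commute)
qed

lemma disjoint_path_edges: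
  assumes "forest V E"
    and p: "directed_path (oriented_arcs E \<omega>) a p s"
    and q: "directed_path (oriented_arcs E \<omega>) s q b"
  shows "path_edges p \<inter> path_edges q = {}"
proof (rule ccontr)
  assume "path_edges p \<inter> path_edges q \<noteq> {}"
  then obtain x y x' y' where
    xy: "(x, y) \<in> path_arcs p" "(x', y') \<in> path_arcs q" "{x, y} = {x', y'}"
    by (auto simp: path_edges_def)
  have "(x, y) \<in> oriented_arcs E \<omega>" "(x', y') \<in> oriented_arcs E \<omega>"
    using p q xy(1,2) by (auto simp: directed_path_def successively_iff_path_arcs)
  \<comment> \<open>The orientation decides in which direction both paths traverse the common edge.\<close>
  then have "y = y'" using xy(3) by (simp add: oriented_arcs_def)
  then have "(x', y') = (x, y)" using xy(3) by (auto simp: doubleton_eq_iff)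
  then show False using common_arc_impossible[OF assms xy(1)] xy(2) by simp
qed

section \<open>Independence of cylinder events\<close>

lemma measure_PiM_cylinder:
  assumes "\<And>i. i \<in> I \<Longrightarrow> prob_space (M i)" "finite J" "J \<subseteq> I"
    and "\<And>j. j \<in> J \<Longrightarrow> X j \<in> sets (M j)"
  shows "{\<omega> \<in> space (PiM I M). \<forall>j\<in>J. \<omega> j \<in> X j} \<in> sets (PiM I M)" (is "?C \<in> _")
    and "measure (PiM I M) {\<omega> \<in> space (PiM I M). \<forall>j\<in>J. \<omega> j \<in> X j} =
      (\<Prod>j\<in>J. measure (M j) (X j))"
proof -
  show "?C \<in> sets (PiM I M)"
    using assms(2-4) by (intro sets.sets_Collect_finite_All sets_Collect_single) auto
  have "?C = prod_emb I M J (Pi\<^sub>E J X)"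
    using assms(3) by (auto simp: prod_emb_def space_PiM)
  then have "emeasure (PiM I M) ?C = (\<Prod>j\<in>J. emeasure (M j) (X j))"
    using emeasure_PiM_emb[of I M J X] assms by simp
  also have "\<dots> = (\<Prod>j\<in>J. ennreal (measure (M j) (X j)))"
    using assms(1,3)
    by (intro prod.cong) (auto intro!: finite_measure.emeasure_eq_measure prob_space.finite_measure)
  finally show "measure (PiM I M) ?C = (\<Prod>j\<in>J. measure (M j) (X j))"
    by (simp add: measure_def prod_ennreal prod_nonneg)
qed

lemma (in prob_space) indep_eventI:
  assumes "A \<in> events" "B \<in> events" "prob (A \<inter> B) = prob A * prob B"
  shows "indep_event A B"
  unfolding indep_event_def indep_events_def
proof (intro conjI allI impI)
  show "case_bool A B ` UNIV \<subseteq> events"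
    using assms by (auto split: bool.splits)
  fix J :: "bool set" assume "J \<noteq> {}"
  moreover have "J \<in> Pow {True, False}" by auto
  ultimately consider "J = {True}" | "J = {False}" | "J = {True, False}" by (auto simp: Pow_insert)
  then show "prob (\<Inter>j\<in>J. case_bool A B j) = (\<Prod>j\<in>J. prob (case_bool A B j))"
    by cases (simp_all add: assms(3))
qed

text \<open>
  As \<open>J\<close> and \<open>K\<close> are disjoint, the intersection is again a cylinder, over \<open>J \<union> K\<close>, and the
  product that gives its measure splits into the parts over \<open>J\<close> and over \<open>K\<close>.
\<close>

lemma indep_event_PiM_cylinders:
  assumes M: "\<And>i. i \<in> I \<Longrightarrow> prob_space (M i)"
    and J: "finite J" "J \<subseteq> I" "\<And>j. j \<in> J \<Longrightarrow> X j \<in> sets (M j)"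
    and K: "finite K" "K \<subseteq> I" "\<And>k. k \<in> K \<Longrightarrow> Y k \<in> sets (M k)"
    and disj: "J \<inter> K = {}"
  shows "prob_space.indep_event (PiM I M)
    {\<omega> \<in> space (PiM I M). \<forall>j\<in>J. \<omega> j \<in> X j} {\<omega> \<in> space (PiM I M). \<forall>k\<in>K. \<omega> k \<in> Y k}"
    (is "prob_space.indep_event _ ?A ?B")
proof -
  interpret prob_space "PiM I M" using M by (rule prob_space_PiM)
  define Z where "Z i = (if i \<in> J then X i else Y i)" for i
  have "?A \<inter> ?B = {\<omega> \<in> space (PiM I M). \<forall>i\<in>J \<union> K. \<omega> i \<in> Z i}"
    using disj by (auto simp: Z_def)
  also have "prob \<dots> = (\<Prod>i\<in>J \<union> K. measure (M i) (Z i))"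
    using J K by (intro measure_PiM_cylinder(2) M) (auto simp: Z_def)
  also have "\<dots> = (\<Prod>i\<in>J. measure (M i) (Z i)) * (\<Prod>i\<in>K. measure (M i) (Z i))"
    using J K disj by (intro prod.union_disjoint)
  also have "(\<Prod>i\<in>J. measure (M i) (Z i)) = (\<Prod>i\<in>J. measure (M i) (X i))"
    by (intro prod.cong) (auto simp: Z_def)
  also have "(\<Prod>i\<in>K. measure (M i) (Z i)) = (\<Prod>i\<in>K. measure (M i) (Y i))"
    using disj by (intro prod.cong) (auto simp: Z_def)
  also have "(\<Prod>i\<in>J. measure (M i) (X i)) = prob ?A"
    by (rule measure_PiM_cylinder(2)[symmetric]) (fact M J)+
  also have "(\<Prod>i\<in>K. measure (M i) (Y i)) = prob ?B"
    by (rule measure_PiM_cylinder(2)[symmetric]) (fact M K)+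
  finally have "prob (?A \<inter> ?B) = prob ?A * prob ?B" .
  moreover have "?A \<in> events" by (rule measure_PiM_cylinder(1)) (fact M J)+
  moreover have "?B \<in> events" by (rule measure_PiM_cylinder(1)) (fact M K)+
  ultimately show ?thesis by (intro indep_eventI)
qed

section \<open>Path events as cylinders\<close>

text \<open>
  The condition that an orientation follows \<open>p\<close> is stated edge by edge, as membership of
  the head of \<open>e\<close> in a set depending on \<open>e\<close>, to give it the form of a cylinder. If \<open>e\<close> is
  an edge of a path \<open>p\<close>, this set is the singleton of the later end of \<open>e\<close> on \<open>p\<close>.
\<close>

definition allowed_heads :: "'a list \<Rightarrow> 'a set \<Rightarrow> 'a set" where
  "allowed_heads p e = {w \<in> e. \<forall>(x, y) \<in> path_arcs p. {x, y} = e \<longrightarrow> w = y}"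

text \<open>
  By uniqueness, any directed path from \<open>u\<close> to \<open>v\<close> is \<open>p\<close> itself, whatever the orientation;
  so the event only asks that the arcs of \<open>p\<close> point forwards.
\<close>

lemma path_event_eq_cylinder:
  assumes "forest V E" "directed_path (adjacency E) u p v"
  shows "path_event E u v =
    {\<omega> \<in> space (random_orientation E). \<forall>e\<in>path_edges p. \<omega> e \<in> allowed_heads p e}"
proof -
  have arcs: "path_arcs p \<subseteq> adjacency E"
    using assms(2) by (simp add: directed_path_def successively_iff_path_arcs)
  have "(\<exists>q. directed_path (oriented_arcs E \<omega>) u q v) \<longleftrightarrow>
      (\<forall>e\<in>path_edges p. \<omega> e \<in> allowed_heads p e)"
    for \<omega>
  proof -
    have "(\<exists>q. directed_path (oriented_arcs E \<omega>) u q v) \<longleftrightarrow>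
        directed_path (oriented_arcs E \<omega>) u p v"
      using forest_path_unique[OF assms] directed_path_mono oriented_arcs_subset_adjacency
      by metis
    also have "\<dots> \<longleftrightarrow> path_arcs p \<subseteq> oriented_arcs E \<omega>"
      using assms(2) by (simp add: directed_path_def successively_iff_path_arcs)
    also have "\<dots> \<longleftrightarrow> (\<forall>(x, y)\<in>path_arcs p. \<omega> {x, y} = y)"
      using arcs by (auto simp: oriented_arcs_def adjacency_def)
    also have "\<dots> \<longleftrightarrow> (\<forall>e\<in>path_edges p. \<omega> e \<in> allowed_heads p e)"
    proof
      assume *: "\<forall>(x, y)\<in>path_arcs p. \<omega> {x, y} = y"
      show "\<forall>e\<in>path_edges p. \<omega> e \<in> allowed_heads p e"
        using * by (force simp: path_edges_def allowed_heads_def)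
    next
      assume "\<forall>e\<in>path_edges p. \<omega> e \<in> allowed_heads p e"
      then show "\<forall>(x, y)\<in>path_arcs p. \<omega> {x, y} = y"
        by (fastforce simp: path_edges_def allowed_heads_def)
    qed
    finally show ?thesis .
  qed
  then show ?thesis by (auto simp: path_event_def)
qed

theorem theorem5p2:
  fixes V :: "'a set" and E :: "'a set set" and a s b :: 'a
  assumes "forest V E"
    and "a \<in> V" and "s \<in> V" and "b \<in> V"
    and "a \<noteq> s" and "s \<noteq> b" and "a \<noteq> b"
  shows "prob_space.indep_event (random_orientation E) (path_event E a s) (path_event E s b)
    \<or> path_event E a s \<inter> path_event E s b = {}"
proof (cases "path_event E a s \<inter> path_event E s b = {}")
  case False
  then obtain \<omega> p q where p: "directed_path (oriented_arcs E \<omega>) a p s"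
    and q: "directed_path (oriented_arcs E \<omega>) s q b"
    by (auto simp: path_event_def)
  have p': "directed_path (adjacency E) a p s" and q': "directed_path (adjacency E) s q b"
    using p q directed_path_mono oriented_arcs_subset_adjacency by metis+
  have prob: "prob_space (uniform_count_measure e)" if "e \<in> E" for e
  proof -
    have "card e = 2" using that assms(1) by (simp add: forest_def simple_graph_def)
    then show ?thesis
      by (intro prob_space_uniform_count_measure) (auto intro: card_ge_0_finite)
  qed
  have heads: "allowed_heads r e \<in> sets (uniform_count_measure e)" for r e
    by (auto simp: allowed_heads_def sets_uniform_count_measure)
  have "prob_space.indep_event (random_orientation E) (path_event E a s) (path_event E s b)"
    unfolding path_event_eq_cylinder[OF assms(1) p'] path_event_eq_cylinder[OF assms(1) q']
      random_orientation_def
    by (rule indep_event_PiM_cylinders[OF prob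
          finite_path_edges path_edges_subset[OF p'] heads
          finite_path_edges path_edges_subset[OF q'] heads
          disjoint_path_edges[OF assms(1) p q]])
  then show ?thesis ..
qed simp

end
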